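(* The sub-poset $\mathbf{cBA}$ of $\mathbf{DL}$ is closed under arbitrary meets, and therefore is a complete lattice. The join in $\mathbf{cBA}$ of $\{\langle X_i\rangle\}$ is $A^2\left(\bigvee\langle X_i\rangle\right)$. Every element in $\mathbf{cBA}$ is complemented, so $\mathbf{cBA}$ is in fact a complete Boolean algebra. The inclusion $\mathbf{cBA}\to\mathbf{DL}$ preserves arbitrary meets, and its left adjoint is given by $A^2\colon\mathbf{DL}\to\mathbf{cBA}$.
   Context: Fix a prime $p$; "spectrum" means object of the $p$-local stable homotopy category. For a spectrum $E$, the Bousfield class $\langle E\rangle$ is the collection of spectra $Z$ with $E\wedge Z=0$. Order Bousfield classes by $\langle E\rangle\ge\langle F\rangle$ iff $E\wedge Z=0$ implies $F\wedge Z=0$ for all $Z$. By Ohkawa's theorem the Bousfield classes form a set $\mathbf{B}$; it is a complete lattice with joins $\bigvee\langle E_i\rangle=\langle\bigvee E_i\rangle$. The smash product of classes is $\langle E\rangle\wedge\langle F\rangle=\langle E\wedge F\rangle$. $\mathbf{DL}\subseteq\mathbf{B}$ is the sub-poset of classes with $\langle E\rangle=\langle E\rangle\wedge\langle E\rangle$; it is a frame (complete lattice whose binary meets distribute over arbitrary joins), with joins as in $\mathbf{B}$ and binary meet the smash product. Put $a\langle X\rangle=\bigvee\{\langle Y\rangle\in\mathbf{B}:\langle X\rangle\wedge\langle Y\rangle=\langle 0\rangle\}$ and $r\langle X\rangle=\bigvee\{\langle Y\rangle\in\mathbf{DL}:\langle Y\rangle\le\langle X\rangle\}$. The complement operation $A\colon\mathbf{DL}\to\mathbf{DL}$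 is $A\langle X\rangle=r(a\langle X\rangle)$. A class $\langle X\rangle$ is closed if $\langle X\rangle\in\mathbf{DL}$ and $A^2\langle X\rangle=\langle X\rangle$; $\mathbf{cBA}\subseteq\mathbf{DL}$ is the sub-poset of closed classes. An order-preserving map $f$ is left adjoint to $g$ iff ($fx\le y\Leftrightarrow x\le gy$). "Arbitrary meets" are meets in $\mathbf{DL}$; "complemented" is meant within the lattice $\mathbf{cBA}$. *)

theory Defs
  imports "HOL-Algebra.Galois_Connection" "HOL-Homology.Homology"
    "HOL-Computational_Algebra.Primes"
begin

section \<open>The p-local stable homotopy category\<close>

text \<open>
  No library constructs the stable homotopy category, so it is specified by axioms in the style
  of Margolis and of Hovey, Palmieri and Strickland: a tensor triangulated category with
  coproducts (wedges), compactly generated by the sphere, whose stable maps between spheres are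
  the \<open>p\<close>-localised stable homotopy classes of actual maps between topological spheres.

  The type \<open>'o\<close> consists of the spectra, and \<open>Mor X Y\<close> is the abelian group of
  morphisms, written multiplicatively following the library: \<open>\<one>\<close> is the zero
  morphism, \<open>\<otimes>\<close> is the sum, \<open>inv\<close> the negative, and \<open>f [^] q\<close>
  the multiple \<open>q f\<close>.
\<close>

record ('o, 'm) tensor_triangulated =
  Mor :: "'o \<Rightarrow> 'o \<Rightarrow> 'm monoid"
  Ident :: "'o \<Rightarrow> 'm"
  Comp :: "'m \<Rightarrow> 'm \<Rightarrow> 'm" (infixr \<open>\<odot>\<index>\<close> 75)
  Susp :: "'o \<Rightarrow> 'o"
  SuspM :: "'m \<Rightarrow> 'm"
  Triangles :: "('o \<times> 'o \<times> 'o \<times> 'm \<times> 'm \<times> 'm) set"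
  Smash :: "'o \<Rightarrow> 'o \<Rightarrow> 'o" (infixl \<open>\<triangle>\<index>\<close> 80)
  SmashM :: "'m \<Rightarrow> 'm \<Rightarrow> 'm" (infixl \<open>\<diamondop>\<index>\<close> 80)
  Sphere :: "'o"
  Assoc :: "'o \<Rightarrow> 'o \<Rightarrow> 'o \<Rightarrow> 'm"
  LUnit :: "'o \<Rightarrow> 'm"
  Braid :: "'o \<Rightarrow> 'o \<Rightarrow> 'm"
  SuspSmash :: "'o \<Rightarrow> 'o \<Rightarrow> 'm"

abbreviation arrows :: "('o, 'm) tensor_triangulated \<Rightarrow> 'o \<Rightarrow> 'o \<Rightarrow> 'm set"
  where "arrows C X Y \<equiv> carrier (Mor C X Y)"

abbreviation zero_arrow :: "('o, 'm) tensor_triangulated \<Rightarrow> 'o \<Rightarrow> 'o \<Rightarrow> 'm"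
  where "zero_arrow C X Y \<equiv> \<one>\<^bsub>Mor C X Y\<^esub>"

definition is_zero_object :: "('o, 'm) tensor_triangulated \<Rightarrow> 'o \<Rightarrow> bool"
  where "is_zero_object C X \<longleftrightarrow>
    (\<forall>Y. arrows C X Y = {zero_arrow C X Y} \<and> arrows C Y X = {zero_arrow C Y X})"

definition is_iso :: "('o, 'm) tensor_triangulated \<Rightarrow> 'o \<Rightarrow> 'o \<Rightarrow> 'm \<Rightarrow> bool"
  where "is_iso C X Y f \<longleftrightarrow> f \<in> arrows C X Y \<and>
    (\<exists>g \<in> arrows C Y X. g \<odot>\<^bsub>C\<^esub> f = Ident C X \<and> f \<odot>\<^bsub>C\<^esub> g = Ident C Y)"

definition is_coproduct ::
    "('o, 'm) tensor_triangulated \<Rightarrow> 'i set \<Rightarrow> ('i \<Rightarrow> 'o) \<Rightarrow> 'o \<Rightarrow> ('i \<Rightarrow> 'm) \<Rightarrow> bool"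
  where "is_coproduct C J X W \<iota> \<longleftrightarrow>
    (\<forall>j\<in>J. \<iota> j \<in> arrows C (X j) W) \<and>
    (\<forall>Y f. (\<forall>j\<in>J. f j \<in> arrows C (X j) Y) \<longrightarrow>
      (\<exists>!h. h \<in> arrows C W Y \<and> (\<forall>j\<in>J. h \<odot>\<^bsub>C\<^esub> \<iota> j = f j)))"

locale preadditive_category =
  fixes C :: "('o, 'm) tensor_triangulated" (structure)
  assumes mor_group: "comm_group (Mor C X Y)"
    and ident_closed: "Ident C X \<in> arrows C X X"
    and comp_closed: "\<lbrakk>f \<in> arrows C X Y; g \<in> arrows C Y Z\<rbrakk> \<Longrightarrow> g \<odot> f \<in> arrows C X Z"
    and comp_assoc: "\<lbrakk>f \<in> arrows C W X; g \<in> arrows C X Y; h \<in> arrows C Y Z\<rbrakk>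
      \<Longrightarrow> (h \<odot> g) \<odot> f = h \<odot> (g \<odot> f)"
    and comp_ident: "f \<in> arrows C X Y \<Longrightarrow> f \<odot> Ident C X = f"
    and ident_comp: "f \<in> arrows C X Y \<Longrightarrow> Ident C Y \<odot> f = f"
    and comp_add_left: "\<lbrakk>f \<in> arrows C X Y; g \<in> arrows C Y Z; g' \<in> arrows C Y Z\<rbrakk>
      \<Longrightarrow> (g \<otimes>\<^bsub>Mor C Y Z\<^esub> g') \<odot> f = (g \<odot> f) \<otimes>\<^bsub>Mor C X Z\<^esub> (g' \<odot> f)"
    and comp_add_right: "\<lbrakk>f \<in> arrows C X Y; f' \<in> arrows C X Y; g \<in> arrows C Y Z\<rbrakk>
      \<Longrightarrow> g \<odot> (f \<otimes>\<^bsub>Mor C X Y\<^esub> f') = (g \<odot> f) \<otimes>\<^bsub>Mor C X Z\<^esub> (g \<odot> f')"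

text \<open>
  The set \<open>I\<close> bounds the size of the families that are regarded as small; asking for
  coproducts of families of unrestricted size over a fixed type of objects would be inconsistent.
\<close>

locale category_with_wedges = preadditive_category C
  for I :: "'i set" and C :: "('o, 'm) tensor_triangulated" (structure) +
  assumes infinite_index: "infinite I"
    and wedge_exists: "J \<subseteq> I \<Longrightarrow> \<exists>W \<iota>. is_coproduct C J (D :: 'i \<Rightarrow> 'o) W \<iota>"

locale triangulated_category = preadditive_category C
  for C :: "('o, 'm) tensor_triangulated" (structure) +
  assumes zero_exists: "\<exists>X. is_zero_object C X"
    and biproduct_exists: "\<exists>W \<iota>. is_coproduct C UNIV (D :: bool \<Rightarrow> 'o) W \<iota>"
    and susp_bij: "bij_betw (SuspM C) (arrows C X Y) (arrows C (Susp C X) (Susp C Y))"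
    and susp_add: "\<lbrakk>f \<in> arrows C X Y; g \<in> arrows C X Y\<rbrakk> \<Longrightarrow>
      SuspM C (f \<otimes>\<^bsub>Mor C X Y\<^esub> g)
        = SuspM C f \<otimes>\<^bsub>Mor C (Susp C X) (Susp C Y)\<^esub> SuspM C g"
    and susp_ident: "SuspM C (Ident C X) = Ident C (Susp C X)"
    and susp_comp: "\<lbrakk>f \<in> arrows C X Y; g \<in> arrows C Y Z\<rbrakk>
      \<Longrightarrow> SuspM C (g \<odot> f) = SuspM C g \<odot> SuspM C f"
    and desuspension: "\<exists>Y f. is_iso C X (Susp C Y) f"
    and triangle_arrows: "(X, Y, Z, f, g, h) \<in> Triangles C
      \<Longrightarrow> f \<in> arrows C X Y \<and> g \<in> arrows C Y Z \<and> h \<in> arrows C Z (Susp C X)"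
    and triangle_iso: "\<lbrakk>(X, Y, Z, f, g, h) \<in> Triangles C;
      is_iso C X X' u; is_iso C Y Y' v; is_iso C Z Z' w;
      f' \<in> arrows C X' Y'; g' \<in> arrows C Y' Z'; h' \<in> arrows C Z' (Susp C X');
      v \<odot> f = f' \<odot> u; w \<odot> g = g' \<odot> v; SuspM C u \<odot> h = h' \<odot> w\<rbrakk>
      \<Longrightarrow> (X', Y', Z', f', g', h') \<in> Triangles C"
    and triangle_ident: "is_zero_object C Z
      \<Longrightarrow> (X, X, Z, Ident C X, zero_arrow C X Z, zero_arrow C Z (Susp C X)) \<in> Triangles C"
    and cofibre: "f \<in> arrows C X Y \<Longrightarrow> \<exists>Z g h. (X, Y, Z, f, g, h) \<in> Triangles C"
    and rotate: "\<lbrakk>f \<in> arrows C X Y; g \<in> arrows C Y Z; h \<in> arrows C Z (Susp C X)\<rbrakk> \<Longrightarrow>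
      (X, Y, Z, f, g, h) \<in> Triangles C \<longleftrightarrow>
      (Y, Z, Susp C X, g, h, inv\<^bsub>Mor C (Susp C X) (Susp C Y)\<^esub> (SuspM C f)) \<in> Triangles C"
    and triangle_fill: "\<lbrakk>(X, Y, Z, f, g, h) \<in> Triangles C; (X', Y', Z', f', g', h') \<in> Triangles C;
      u \<in> arrows C X X'; v \<in> arrows C Y Y'; v \<odot> f = f' \<odot> u\<rbrakk>
      \<Longrightarrow> \<exists>w \<in> arrows C Z Z'. w \<odot> g = g' \<odot> v \<and> SuspM C u \<odot> h = h' \<odot> w"
    and octahedron: "\<lbrakk>(X, Y, Z', u, i, i') \<in> Triangles C; (Y, Z, X', v, j, j') \<in> Triangles C;
      (X, Z, Y', v \<odot> u, k, k') \<in> Triangles C\<rbrakk>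
      \<Longrightarrow> \<exists>m n. (Z', Y', X', m, n, SuspM C i \<odot> j') \<in> Triangles C
        \<and> m \<odot> i = k \<odot> v \<and> k' \<odot> m = i' \<and> n \<odot> k = j \<and> j' \<odot> n = SuspM C u \<odot> k'"

locale symmetric_monoidal_category = preadditive_category C
  for C :: "('o, 'm) tensor_triangulated" (structure) +
  assumes smash_closed: "\<lbrakk>f \<in> arrows C X X'; g \<in> arrows C Y Y'\<rbrakk>
      \<Longrightarrow> f \<diamondop> g \<in> arrows C (X \<triangle> Y) (X' \<triangle> Y')"
    and smash_ident: "Ident C X \<diamondop> Ident C Y = Ident C (X \<triangle> Y)"
    and smash_comp: "\<lbrakk>f \<in> arrows C X X'; f' \<in> arrows C X' X''; g \<in> arrows C Y Y'; g' \<in> arrows C Y' Y''\<rbrakk>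
      \<Longrightarrow> (f' \<odot> f) \<diamondop> (g' \<odot> g) = (f' \<diamondop> g') \<odot> (f \<diamondop> g)"
    and smash_add: "\<lbrakk>f \<in> arrows C X X'; f' \<in> arrows C X X'; g \<in> arrows C Y Y'\<rbrakk>
      \<Longrightarrow> (f \<otimes>\<^bsub>Mor C X X'\<^esub> f') \<diamondop> g
        = (f \<diamondop> g) \<otimes>\<^bsub>Mor C (X \<triangle> Y) (X' \<triangle> Y')\<^esub> (f' \<diamondop> g)"
    and assoc_iso: "is_iso C ((X \<triangle> Y) \<triangle> Z) (X \<triangle> (Y \<triangle> Z)) (Assoc C X Y Z)"
    and assoc_natural: "\<lbrakk>f \<in> arrows C X X'; g \<in> arrows C Y Y'; h \<in> arrows C Z Z'\<rbrakk>
      \<Longrightarrow> Assoc C X' Y' Z' \<odot> ((f \<diamondop> g) \<diamondop> h) = (f \<diamondop> (g \<diamondop> h)) \<odot> Assoc C X Y Z"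
    and lunit_iso: "is_iso C (Sphere C \<triangle> X) X (LUnit C X)"
    and lunit_natural: "f \<in> arrows C X X'
      \<Longrightarrow> LUnit C X' \<odot> (Ident C (Sphere C) \<diamondop> f) = f \<odot> LUnit C X"
    and braid_closed: "Braid C X Y \<in> arrows C (X \<triangle> Y) (Y \<triangle> X)"
    and braid_natural: "\<lbrakk>f \<in> arrows C X X'; g \<in> arrows C Y Y'\<rbrakk>
      \<Longrightarrow> Braid C X' Y' \<odot> (f \<diamondop> g) = (g \<diamondop> f) \<odot> Braid C X Y"
    and braid_symmetric: "Braid C Y X \<odot> Braid C X Y = Ident C (X \<triangle> Y)"
    and pentagon: "Assoc C W X (Y \<triangle> Z) \<odot> Assoc C (W \<triangle> X) Y Z
      = (Ident C W \<diamondop> Assoc C X Y Z) \<odot> Assoc C W (X \<triangle> Y) Z \<odot> (Assoc C W X Y \<diamondop> Ident C Z)"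
    and unit_coherence: "(Ident C X \<diamondop> LUnit C Y) \<odot> Assoc C X (Sphere C) Y
      = (LUnit C X \<odot> Braid C X (Sphere C)) \<diamondop> Ident C Y"
    and hexagon: "Assoc C Y Z X \<odot> Braid C X (Y \<triangle> Z) \<odot> Assoc C X Y Z
      = (Ident C Y \<diamondop> Braid C X Z) \<odot> Assoc C Y X Z \<odot> (Braid C X Y \<diamondop> Ident C Z)"

text \<open>
  Exactness of the smash product; \<open>SuspSmash X Y\<close> is the natural isomorphism from
  \<open>(\<Sigma>X) \<and> Y\<close> to \<open>\<Sigma>(X \<and> Y)\<close>. Preservation of wedges is what
  remains here of closedness (a left adjoint preserves coproducts).
\<close>

locale stable_homotopy_category =
    category_with_wedges I C + triangulated_category C + symmetric_monoidal_category C
  for I :: "'i set" and C :: "('o, 'm) tensor_triangulated" (structure) +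
  assumes susp_smash_iso: "is_iso C (Susp C X \<triangle> Y) (Susp C (X \<triangle> Y)) (SuspSmash C X Y)"
    and susp_smash_natural: "\<lbrakk>f \<in> arrows C X X'; g \<in> arrows C Y Y'\<rbrakk>
      \<Longrightarrow> SuspSmash C X' Y' \<odot> (SuspM C f \<diamondop> g) = SuspM C (f \<diamondop> g) \<odot> SuspSmash C X Y"
    and susp_smash_assoc: "SuspM C (Assoc C X Y Z) \<odot> SuspSmash C (X \<triangle> Y) Z
        \<odot> (SuspSmash C X Y \<diamondop> Ident C Z)
      = SuspSmash C X (Y \<triangle> Z) \<odot> Assoc C (Susp C X) Y Z"
    and susp_smash_unit: "SuspM C (LUnit C X \<odot> Braid C X (Sphere C)) \<odot> SuspSmash C X (Sphere C)
      = LUnit C (Susp C X) \<odot> Braid C (Susp C X) (Sphere C)"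
    and susp_braid: "Braid C (Susp C (Sphere C)) (Susp C (Sphere C))
      = inv\<^bsub>Mor C (Susp C (Sphere C) \<triangle> Susp C (Sphere C))
               (Susp C (Sphere C) \<triangle> Susp C (Sphere C))\<^esub>
          (Ident C (Susp C (Sphere C) \<triangle> Susp C (Sphere C)))"
    and smash_exact: "(X, Y, Z, f, g, h) \<in> Triangles C \<Longrightarrow>
      (X \<triangle> W, Y \<triangle> W, Z \<triangle> W, f \<diamondop> Ident C W, g \<diamondop> Ident C W,
        SuspSmash C X W \<odot> (h \<diamondop> Ident C W)) \<in> Triangles C"
    and smash_wedge: "\<lbrakk>J \<subseteq> I; is_coproduct C J D W \<iota>\<rbrakk>
      \<Longrightarrow> is_coproduct C J (\<lambda>j. D j \<triangle> Y) (W \<triangle> Y) (\<lambda>j. \<iota> j \<diamondop> Ident C Y)"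
    and sphere_compact: "\<lbrakk>J \<subseteq> I; is_coproduct C J D W \<iota>; f \<in> arrows C (Sphere C) W\<rbrakk>
      \<Longrightarrow> \<exists>K k. K \<subseteq> J \<and> finite K \<and> (\<forall>j\<in>K. k j \<in> arrows C (Sphere C) (D j)) \<and>
        f = finprod (Mor C (Sphere C) W) (\<lambda>j. \<iota> j \<odot> k j) K"
    and sphere_generates:
      "(\<And>m n. arrows C ((Susp C ^^ m) (Sphere C)) ((Susp C ^^ n) X)
          = {zero_arrow C ((Susp C ^^ m) (Sphere C)) ((Susp C ^^ n) X)})
        \<Longrightarrow> is_zero_object C X"

text \<open>
  The unreduced suspension of a map from the \<open>a\<close>-sphere to the \<open>b\<close>-sphere; the
  suspension coordinate is the new last coordinate.
\<close>

definition nsphere_susp ::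
    "nat \<Rightarrow> nat \<Rightarrow> ((nat \<Rightarrow> real) \<Rightarrow> nat \<Rightarrow> real) \<Rightarrow> (nat \<Rightarrow> real) \<Rightarrow> nat \<Rightarrow> real"
  where "nsphere_susp a b f x =
    (let t = x (Suc a); r = sqrt (1 - t\<^sup>2)
     in (\<lambda>i. if i = Suc b then t else r * f (\<lambda>k. if k \<le> a then x k / r else 0) i))"

primrec nsphere_susp_iter ::
    "nat \<Rightarrow> nat \<Rightarrow> nat \<Rightarrow> ((nat \<Rightarrow> real) \<Rightarrow> nat \<Rightarrow> real) \<Rightarrow> (nat \<Rightarrow> real) \<Rightarrow> nat \<Rightarrow> real"
  where
    "nsphere_susp_iter 0 a b f = f"
  | "nsphere_susp_iter (Suc m) a b f = nsphere_susp (a + m) (b + m) (nsphere_susp_iter m a b f)"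

text \<open>
  \<open>\<Phi> a b f\<close> is the stable map from \<open>\<Sigma>\<^sup>a S\<close> to
  \<open>\<Sigma>\<^sup>b S\<close> induced by \<open>f\<close>. The last two clauses say that it identifies
  the maps between sphere spectra with the stable stems localised at \<open>p\<close>: up to multiples
  prime to \<open>p\<close>, every stable map comes from a map of spheres after suspension, and
  only stably null maps go to zero (a self-map \<open>d\<close> of degree \<open>q\<close> is used to
  multiply by \<open>q\<close>). The additivity clause concerns the sum \<open>f\<close> of two maps
  obtained by pinching the equator.
\<close>

definition realizes_local_stems :: "nat \<Rightarrow> ('o, 'm) tensor_triangulated \<Rightarrow>
    (nat \<Rightarrow> nat \<Rightarrow> ((nat \<Rightarrow> real) \<Rightarrow> nat \<Rightarrow> real) \<Rightarrow> 'm) \<Rightarrow> bool"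
  where "realizes_local_stems p C \<Phi> \<longleftrightarrow>
    (let S = (\<lambda>a. (Susp C ^^ a) (Sphere C)) in
     (\<forall>a b f. continuous_map (nsphere a) (nsphere b) f \<longrightarrow>
        \<Phi> a b f \<in> arrows C (S a) (S b)) \<and>
     (\<forall>a b f g. homotopic_with (\<lambda>_. True) (nsphere a) (nsphere b) f g \<longrightarrow>
        \<Phi> a b f = \<Phi> a b g) \<and>
     (\<forall>a. \<Phi> a a (\<lambda>x. x) = Ident C (S a)) \<and>
     (\<forall>a b c f g. continuous_map (nsphere a) (nsphere b) f \<and>
        continuous_map (nsphere b) (nsphere c) g \<longrightarrow>
        \<Phi> a c (g \<circ> f) = \<Phi> b c g \<odot>\<^bsub>C\<^esub> \<Phi> a b f) \<and>
     (\<forall>a b f. continuous_map (nsphere a) (nsphere b) f \<longrightarrow>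
        \<Phi> (Suc a) (Suc b) (nsphere_susp a b f) = SuspM C (\<Phi> a b f)) \<and>
     (\<forall>a b f g h c. continuous_map (nsphere a) (nsphere b) f \<and>
        continuous_map (nsphere a) (nsphere b) g \<and> continuous_map (nsphere a) (nsphere b) h \<and>
        (\<forall>x \<in> topspace (nsphere a).
          (x a \<ge> 0 \<longrightarrow> f x = g x \<and> h x = c) \<and> (x a \<le> 0 \<longrightarrow> f x = h x \<and> g x = c)) \<longrightarrow>
        \<Phi> a b f = \<Phi> a b g \<otimes>\<^bsub>Mor C (S a) (S b)\<^esub> \<Phi> a b h) \<and>
     (\<forall>a b u. u \<in> arrows C (S a) (S b) \<longrightarrow>
        (\<exists>m q f. q > 0 \<and> coprime q p \<and> continuous_map (nsphere (a + m)) (nsphere (b + m)) f \<and>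
          \<Phi> (a + m) (b + m) f
            = (SuspM C ^^ m) u [^]\<^bsub>Mor C (S (a + m)) (S (b + m))\<^esub> (q::nat))) \<and>
     (\<forall>a b f. continuous_map (nsphere a) (nsphere b) f \<and> \<Phi> a b f = zero_arrow C (S a) (S b) \<longrightarrow>
        (\<exists>m q d c. q > 0 \<and> coprime q p \<and> continuous_map (nsphere (a + m)) (nsphere (a + m)) d \<and>
          Brouwer_degree2 (a + m) d = int q \<and>
          homotopic_with (\<lambda>_. True) (nsphere (a + m)) (nsphere (b + m))
            (nsphere_susp_iter m a b f \<circ> d) (\<lambda>_. c))))"

text \<open>The Bousfield class of a spectrum \<open>E\<close> is the collection of \<open>E\<close>-acyclic spectra.\<close>

definition bousfield_class :: "('o, 'm) tensor_triangulated \<Rightarrow> 'o \<Rightarrow> 'o set"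
  where "bousfield_class C E = {Z. is_zero_object C (E \<triangle>\<^bsub>C\<^esub> Z)}"

text \<open>
  Ohkawa's theorem enters as an axiom in the form: the Bousfield classes are represented by a
  small family, that is, one indexed by \<open>I\<close>.
\<close>

locale p_local_stable_homotopy_category = stable_homotopy_category I C
  for p :: nat and I :: "'i set" and C :: "('o, 'm) tensor_triangulated" (structure) +
  assumes prime_p: "prime p"
    and p_local: "\<lbrakk>prime q; q \<noteq> p\<rbrakk> \<Longrightarrow> is_iso C X X (Ident C X [^]\<^bsub>Mor C X X\<^esub> (q::nat))"
    and local_stems: "\<exists>\<Phi>. realizes_local_stems p C \<Phi>"
    and ohkawa: "\<exists>X :: 'i \<Rightarrow> 'o. range (bousfield_class C) = (bousfield_class C \<circ> X) ` I"


section \<open>The Bousfield lattice\<close>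

definition bousfield_lattice :: "('o, 'm) tensor_triangulated \<Rightarrow> 'o set gorder" (\<open>\<B>\<index>\<close>)
  where "\<B>\<^bsub>C\<^esub> =
    \<lparr>carrier = range (bousfield_class C), eq = (=), le = (\<lambda>x y. y \<subseteq> x)\<rparr>"

text \<open>These two are independent of the chosen representatives, which the definite
  descriptions presuppose.\<close>

definition class_smash :: "('o, 'm) tensor_triangulated \<Rightarrow> 'o set \<Rightarrow> 'o set \<Rightarrow> 'o set"
  where "class_smash C x y = (THE z. \<exists>E F. x = bousfield_class C E \<and> y = bousfield_class C F
    \<and> z = bousfield_class C (E \<triangle>\<^bsub>C\<^esub> F))"

definition class_zero :: "('o, 'm) tensor_triangulated \<Rightarrow> 'o set"
  where "class_zero C = (THE z. \<exists>X. is_zero_object C X \<and> z = bousfield_class C X)"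

definition DL :: "('o, 'm) tensor_triangulated \<Rightarrow> 'o set gorder"
  where "DL C = \<B>\<^bsub>C\<^esub>\<lparr>carrier := {x \<in> carrier \<B>\<^bsub>C\<^esub>. x = class_smash C x x}\<rparr>"

definition annihilator :: "('o, 'm) tensor_triangulated \<Rightarrow> 'o set \<Rightarrow> 'o set"
  where "annihilator C x = \<Squnion>\<^bsub>\<B>\<^bsub>C\<^esub>\<^esub> {y \<in> carrier \<B>\<^bsub>C\<^esub>. class_smash C x y = class_zero C}"

definition retraction :: "('o, 'm) tensor_triangulated \<Rightarrow> 'o set \<Rightarrow> 'o set"
  where "retraction C x = \<Squnion>\<^bsub>\<B>\<^bsub>C\<^esub>\<^esub> {y \<in> carrier (DL C). y \<sqsubseteq>\<^bsub>\<B>\<^bsub>C\<^esub>\<^esub> x}"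

definition complement_op :: "('o, 'm) tensor_triangulated \<Rightarrow> 'o set \<Rightarrow> 'o set"
  where "complement_op C x = retraction C (annihilator C x)"

definition cBA :: "('o, 'm) tensor_triangulated \<Rightarrow> 'o set gorder"
  where "cBA C = \<B>\<^bsub>C\<^esub>\<lparr>carrier :=
    {x \<in> carrier (DL C). complement_op C (complement_op C x) = x}\<rparr>"


section \<open>Complete Boolean algebras\<close>

definition complemented_in :: "('a, 'b) gorder_scheme \<Rightarrow> 'a \<Rightarrow> bool"
  where "complemented_in L x \<longleftrightarrow> x \<in> carrier L \<and>
    (\<exists>y \<in> carrier L. x \<squnion>\<^bsub>L\<^esub> y = \<top>\<^bsub>L\<^esub> \<and> x \<sqinter>\<^bsub>L\<^esub> y = \<bottom>\<^bsub>L\<^esub>)"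

locale complete_boolean_lattice = complete_lattice L for L (structure) +
  assumes distrib: "\<lbrakk>x \<in> carrier L; y \<in> carrier L; z \<in> carrier L\<rbrakk>
      \<Longrightarrow> x \<sqinter> (y \<squnion> z) = (x \<sqinter> y) \<squnion> (x \<sqinter> z)"
    and complemented: "x \<in> carrier L \<Longrightarrow> complemented_in L x"

end

theory Submission
  imports Defs
begin

text \<open>
  Smashing with a spectrum depends only on its Bousfield class and commutes with wedges, and by
  Ohkawa's theorem wedges of arbitrary families of classes exist. So the Bousfield classes form a
  commutative quantale whose unit, the class of the sphere, is the top element. In any such quantale
  the idempotents form a frame with multiplication as meet, the operation \<open>A\<close> is its
  pseudocomplement (\<open>y \<le> A x\<close> iff \<open>x y = 0\<close>), and the theorem is Glivenko's
  theorem on the regular elements of a frame.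
\<close>

section \<open>Suprema and infima in partial orders and their sub-posets\<close>

lemma (in partial_order) partial_order_subset:
  assumes "A \<subseteq> carrier L"
  shows "partial_order (L\<lparr>carrier := A\<rparr>)"
proof -
  interpret W: weak_partial_order "L\<lparr>carrier := A\<rparr>"
    by (rule weak_partial_order_subset) (use assms weak_partial_order_axioms in auto)
  show ?thesis
    by unfold_locales (simp add: eq_is_equal)
qed

text \<open>Suprema are chosen by Hilbert choice among least upper bounds; antisymmetry leaves only
  one candidate.\<close>

lemma (in partial_order) sup_eqI: "least L s (Upper L A) \<Longrightarrow> \<Squnion>A = s"
  unfolding sup_def by (rule some_equality) (auto intro: least_unique)

lemma (in partial_order) inf_eqI: "greatest L i (Lower L A) \<Longrightarrow> \<Sqinter>A = i"
  unfolding inf_def by (rule some_equality) (auto intro: greatest_unique)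

text \<open>Infima come for free: every member of \<open>A\<close> is an upper bound of the set of
  lower bounds of \<open>A\<close>, so the least upper bound of that set is still a lower bound of
  \<open>A\<close>, hence the greatest one.\<close>

lemma (in partial_order) complete_lattice_supI:
  assumes "\<And>A. A \<subseteq> carrier L \<Longrightarrow> \<exists>s. least L s (Upper L A)"
  shows "complete_lattice L"
proof (rule complete_latticeI)
  fix A assume A: "A \<subseteq> carrier L"
  obtain i where i: "least L i (Upper L (Lower L A))"
    using assms by (meson Lower_closed)
  have "greatest L i (Lower L A)"
  proof (rule greatest_LowerI)
    show "i \<sqsubseteq> x" if "x \<in> A" for x
      using A that by (intro least_le[OF i] Upper_memI) auto
    show "y \<sqsubseteq> i" if "y \<in> Lower L A" for y
      using least_Upper_above[OF i that] by simp
  qed (use A i in auto)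
  then show "\<exists>i. greatest L i (Lower L A)" ..
qed (rule assms)

lemma is_lub_substructureI:
  fixes L (structure)
  assumes "A \<subseteq> K" "s \<in> K" "\<And>x. x \<in> A \<Longrightarrow> x \<sqsubseteq> s"
    "\<And>y. \<lbrakk>y \<in> K; \<And>x. x \<in> A \<Longrightarrow> x \<sqsubseteq> y\<rbrakk> \<Longrightarrow> s \<sqsubseteq> y"
  shows "is_lub (L\<lparr>carrier := K\<rparr>) s A"
  using assms by (simp add: least_def Upper_def subset_iff)

lemma is_glb_substructureI:
  fixes L (structure)
  assumes "A \<subseteq> K" "i \<in> K" "\<And>x. x \<in> A \<Longrightarrow> i \<sqsubseteq> x"
    "\<And>y. \<lbrakk>y \<in> K; \<And>x. x \<in> A \<Longrightarrow> y \<sqsubseteq> x\<rbrakk> \<Longrightarrow> y \<sqsubseteq> i"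
  shows "is_glb (L\<lparr>carrier := K\<rparr>) i A"
  using assms by (simp add: greatest_def Lower_def subset_iff)

section \<open>The Boolean algebra of closed idempotents of a quantale\<close>

locale integral_quantale = complete_lattice L for L (structure) +
  fixes mult :: "'a \<Rightarrow> 'a \<Rightarrow> 'a" (infixl \<open>\<cdot>\<close> 75)
  assumes mult_closed [simp]: "\<lbrakk>x \<in> carrier L; y \<in> carrier L\<rbrakk> \<Longrightarrow> x \<cdot> y \<in> carrier L"
    and mult_comm: "\<lbrakk>x \<in> carrier L; y \<in> carrier L\<rbrakk> \<Longrightarrow> x \<cdot> y = y \<cdot> x"
    and mult_assoc: "\<lbrakk>x \<in> carrier L; y \<in> carrier L; z \<in> carrier L\<rbrakk>
      \<Longrightarrow> (x \<cdot> y) \<cdot> z = x \<cdot> (y \<cdot> z)"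
    and mult_top: "x \<in> carrier L \<Longrightarrow> x \<cdot> \<top> = x"
    and mult_sup: "\<lbrakk>x \<in> carrier L; A \<subseteq> carrier L\<rbrakk> \<Longrightarrow> x \<cdot> \<Squnion>A = \<Squnion>((\<cdot>) x ` A)"
begin

section \<open>Monotonicity and absorption in an integral quantale\<close>

lemma mult_left_commute:
  "\<lbrakk>x \<in> carrier L; y \<in> carrier L; z \<in> carrier L\<rbrakk> \<Longrightarrow> x \<cdot> (y \<cdot> z) = y \<cdot> (x \<cdot> z)"
  using mult_assoc[of x y z] mult_assoc[of y x z] by (simp add: mult_comm[of x y])

lemmas mult_ac = mult_assoc mult_comm mult_left_commute

text \<open>Monotonicity is contained in distributivity: \<open>x \<sqsubseteq> y\<close> means that
  \<open>y\<close> is the supremum of \<open>{x, y}\<close>, and multiplication by \<open>z\<close>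
  preserves this supremum.\<close>

lemma mult_mono_right:
  assumes "x \<in> carrier L" "y \<in> carrier L" "z \<in> carrier L" "x \<sqsubseteq> y"
  shows "z \<cdot> x \<sqsubseteq> z \<cdot> y"
proof -
  have "\<Squnion>{x, y} = y"
    using assms by (intro sup_eqI least_UpperI) (auto simp: Upper_def)
  then have "z \<cdot> y = \<Squnion>{z \<cdot> x, z \<cdot> y}"
    using mult_sup[of z "{x, y}"] assms by simp
  moreover have "z \<cdot> x \<sqsubseteq> \<Squnion>{z \<cdot> x, z \<cdot> y}"
    using assms by (intro sup_upper) auto
  ultimately show ?thesis by simp
qed

lemma mult_mono:
  assumes "x \<in> carrier L" "x' \<in> carrier L" "y \<in> carrier L" "y' \<in> carrier L" "x \<sqsubseteq> x'" "y \<sqsubseteq> y'"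
  shows "x \<cdot> y \<sqsubseteq> x' \<cdot> y'"
  using assms
  by (intro le_trans[OF mult_mono_right[of y y' x]])
    (simp_all add: mult_comm[of _ y'] mult_mono_right)

lemma mult_le_left: "\<lbrakk>x \<in> carrier L; y \<in> carrier L\<rbrakk> \<Longrightarrow> x \<cdot> y \<sqsubseteq> x"
  using mult_mono_right[of y \<top> x] by (simp add: mult_top)

lemma mult_le_right: "\<lbrakk>x \<in> carrier L; y \<in> carrier L\<rbrakk> \<Longrightarrow> x \<cdot> y \<sqsubseteq> y"
  using mult_le_left[of y x] by (simp add: mult_comm)

lemma le_bottom_iff: "x \<in> carrier L \<Longrightarrow> x \<sqsubseteq> \<bottom> \<longleftrightarrow> x = \<bottom>"
  by (auto intro: le_antisym)

lemma mult_bottom: "x \<in> carrier L \<Longrightarrow> x \<cdot> \<bottom> = \<bottom>"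
  using mult_le_right[of x \<bottom>] le_bottom_iff by simp

lemma mult_sup_eq_bottom:
  assumes "x \<in> carrier L" "A \<subseteq> carrier L" "\<And>y. y \<in> A \<Longrightarrow> x \<cdot> y = \<bottom>"
  shows "x \<cdot> \<Squnion>A = \<bottom>"
proof -
  have "\<Squnion>((\<cdot>) x ` A) \<sqsubseteq> \<bottom>"
    using assms by (intro sup_least) auto
  then show ?thesis
    using assms(1,2) by (simp flip: mult_sup add: le_bottom_iff)
qed

section \<open>Idempotents, annihilators and the pseudocomplement\<close>

definition idem :: "'a set"
  where "idem = {x \<in> carrier L. x \<cdot> x = x}"

text \<open>Quantale form of \<open>annihilator\<close>, with \<open>\<bottom>\<close> in place of
  \<open>class_zero\<close>; \<open>bousfield_bottom\<close> identifies the two for Bousfield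
  classes.\<close>

definition ann :: "'a \<Rightarrow> 'a"
  where "ann x = \<Squnion>{y \<in> carrier L. x \<cdot> y = \<bottom>}"

definition retr :: "'a \<Rightarrow> 'a"
  where "retr x = \<Squnion>{y \<in> idem. y \<sqsubseteq> x}"

definition neg :: "'a \<Rightarrow> 'a"
  where "neg x = retr (ann x)"

definition regular :: "'a set"
  where "regular = {x \<in> idem. neg (neg x) = x}"

lemma idem_carrier: "idem \<subseteq> carrier L"
  by (auto simp: idem_def)

text \<open>The other inequality holds for every element, because the unit is the top.\<close>

lemma idemI: "\<lbrakk>x \<in> carrier L; x \<sqsubseteq> x \<cdot> x\<rbrakk> \<Longrightarrow> x \<in> idem"
  by (simp add: idem_def le_antisym mult_le_left)

lemma idem_closed [simp]: "x \<in> idem \<Longrightarrow> x \<in> carrier L"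
  and idem_mult_self [simp]: "x \<in> idem \<Longrightarrow> x \<cdot> x = x"
  by (simp_all add: idem_def)

text \<open>Each \<open>x\<close> in \<open>A\<close> satisfies \<open>x = x \<cdot> x\<close>,
  which monotonicity places below the square of the supremum. Joins of idempotents are therefore the
  joins of \<open>L\<close>.\<close>

lemma idem_sup:
  assumes "A \<subseteq> idem"
  shows "\<Squnion>A \<in> idem"
proof (rule idemI)
  have A: "A \<subseteq> carrier L" using assms idem_carrier by blast
  then show "\<Squnion>A \<in> carrier L" by simp
  show "\<Squnion>A \<sqsubseteq> \<Squnion>A \<cdot> \<Squnion>A"
  proof (rule sup_least[OF A])
    fix x assume x: "x \<in> A"
    then have "x \<cdot> x \<sqsubseteq> \<Squnion>A \<cdot> \<Squnion>A"
      using A by (intro mult_mono sup_upper) auto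
    then show "x \<sqsubseteq> \<Squnion>A \<cdot> \<Squnion>A"
      using assms x by (simp add: subset_iff)
  qed (use A in simp)
qed

lemma idem_mult:
  assumes "x \<in> idem" "y \<in> idem"
  shows "x \<cdot> y \<in> idem"
proof -
  have "(x \<cdot> y) \<cdot> (x \<cdot> y) = (x \<cdot> x) \<cdot> (y \<cdot> y)"
    using assms by (simp add: mult_ac del: idem_mult_self)
  then show ?thesis
    using assms by (intro idemI) simp_all
qed

lemma bottom_idem: "\<bottom> \<in> idem"
  by (rule idemI) (simp_all add: mult_bottom)

lemma top_idem: "\<top> \<in> idem"
  by (rule idemI) (simp_all add: mult_top)

text \<open>The product is the binary meet of idempotents: if \<open>z\<close> lies below both
  factors, then \<open>z = z \<cdot> z\<close> lies below their product.\<close>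

lemma le_mult_iff:
  assumes "x \<in> idem" "y \<in> idem" "z \<in> idem"
  shows "z \<sqsubseteq> x \<cdot> y \<longleftrightarrow> z \<sqsubseteq> x \<and> z \<sqsubseteq> y"
proof
  show "z \<sqsubseteq> x \<and> z \<sqsubseteq> y" if "z \<sqsubseteq> x \<cdot> y"
    using assms that by (meson idem_closed le_trans mult_closed mult_le_left mult_le_right)
  show "z \<sqsubseteq> x \<cdot> y" if "z \<sqsubseteq> x \<and> z \<sqsubseteq> y"
    using assms that mult_mono[of z x z y] by simp
qed

lemma retr_idem: "retr x \<in> idem"
  unfolding retr_def by (rule idem_sup) blast

text \<open>A coreflection: \<open>retr x\<close> is a join of idempotents below \<open>x\<close>,
  so it is itself idempotent and still below \<open>x\<close>.\<close>

lemma le_retr_iff: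
  assumes "x \<in> carrier L" "y \<in> idem"
  shows "y \<sqsubseteq> retr x \<longleftrightarrow> y \<sqsubseteq> x"
proof
  have "retr x \<sqsubseteq> x"
    unfolding retr_def using assms by (intro sup_least) auto
  then show "y \<sqsubseteq> x" if "y \<sqsubseteq> retr x"
    using assms that by (meson idem_closed le_trans retr_idem)
  show "y \<sqsubseteq> retr x" if "y \<sqsubseteq> x"
    unfolding retr_def using assms that by (intro sup_upper) auto
qed

lemma ann_closed [simp]: "ann x \<in> carrier L"
  unfolding ann_def by (rule sup_closed) auto

text \<open>Distributivity makes \<open>x\<close> annihilate the supremum \<open>ann x\<close> as
  well, so this is the largest annihilated element.\<close>

lemma le_ann_iff:
  assumes "x \<in> carrier L" "y \<in> carrier L"
  shows "y \<sqsubseteq> ann x \<longleftrightarrow> x \<cdot> y = \<bottom>"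
proof
  have "x \<cdot> ann x = \<bottom>"
    unfolding ann_def using assms by (intro mult_sup_eq_bottom) auto
  then show "x \<cdot> y = \<bottom>" if "y \<sqsubseteq> ann x"
    using mult_mono_right[OF _ _ _ that] assms by (metis ann_closed le_bottom_iff mult_closed)
  show "y \<sqsubseteq> ann x" if "x \<cdot> y = \<bottom>"
    unfolding ann_def using assms that by (intro sup_upper) auto
qed

lemma neg_idem [simp]: "neg x \<in> idem"
  by (simp add: neg_def retr_idem)

lemma neg_closed [simp]: "neg x \<in> carrier L"
  by simp

text \<open>Coreflection and annihilation combined. The later facts on \<open>neg\<close> use this
  equivalence instead of the suprema that define it.\<close>

lemma le_neg_iff:
  assumes "x \<in> carrier L" "y \<in> idem"
  shows "y \<sqsubseteq> neg x \<longleftrightarrow> x \<cdot> y = \<bottom>"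
  using assms by (simp add: neg_def le_retr_iff le_ann_iff)

lemma mult_neg: "x \<in> carrier L \<Longrightarrow> x \<cdot> neg x = \<bottom>"
  using le_neg_iff[of x "neg x"] by simp

text \<open>Both sides say \<open>x \<cdot> y = \<bottom>\<close>. Thus \<open>neg\<close> forms an
  antitone Galois connection with itself, and the rules for double negation follow formally.\<close>

lemma le_neg_commute: "\<lbrakk>x \<in> idem; y \<in> idem\<rbrakk> \<Longrightarrow> y \<sqsubseteq> neg x \<longleftrightarrow> x \<sqsubseteq> neg y"
  by (simp add: le_neg_iff mult_comm)

lemma le_neg_neg: "x \<in> idem \<Longrightarrow> x \<sqsubseteq> neg (neg x)"
  using le_neg_commute[of x "neg x"] by simp

lemma neg_antimono:
  assumes "x \<in> idem" "y \<in> idem" "x \<sqsubseteq> y"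
  shows "neg y \<sqsubseteq> neg x"
proof -
  have "x \<sqsubseteq> neg (neg y)"
    using assms le_neg_neg[of y] by (meson idem_closed le_trans neg_closed)
  then show ?thesis
    using assms le_neg_commute by simp
qed

lemma neg_neg_neg: "x \<in> idem \<Longrightarrow> neg (neg (neg x)) = neg x"
  by (simp add: le_antisym neg_antimono le_neg_neg)

lemma neg_bottom: "neg \<bottom> = \<top>"
  using le_neg_iff[of \<bottom> \<top>] top_idem by (simp add: le_antisym mult_top)

lemma neg_top: "neg \<top> = \<bottom>"
  using mult_neg[of \<top>] by (simp add: mult_comm[of \<top>] mult_top)

section \<open>Regular idempotents and their complete Boolean algebra\<close>

lemma regular_idem: "regular \<subseteq> idem"
  by (auto simp: regular_def)

lemma regular_closed: "regular \<subseteq> carrier L"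
  using regular_idem idem_carrier by blast

lemma neg_regular [simp]: "x \<in> idem \<Longrightarrow> neg x \<in> regular"
  by (simp add: regular_def neg_neg_neg)

lemma regularI: "\<lbrakk>x \<in> idem; neg (neg x) \<sqsubseteq> x\<rbrakk> \<Longrightarrow> x \<in> regular"
  by (simp add: regular_def le_antisym le_neg_neg)

text \<open>Negating \<open>x \<sqsubseteq> y\<close> twice gives
  \<open>neg (neg x) \<sqsubseteq> neg (neg y) = y\<close>. This is the adjunction between double
  negation and the inclusion of the regular elements.\<close>

lemma neg_neg_le_iff:
  assumes "x \<in> idem" "y \<in> regular"
  shows "neg (neg x) \<sqsubseteq> y \<longleftrightarrow> x \<sqsubseteq> y"
proof -
  have y: "y \<in> idem" "neg (neg y) = y" using assms by (auto simp: regular_def)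
  have "neg (neg x) \<sqsubseteq> y" if "x \<sqsubseteq> y"
    using neg_antimono[OF _ _ neg_antimono[OF assms(1) y(1) that]] y by simp
  then show ?thesis
    using assms y le_neg_neg[of x] by (meson idem_closed le_trans neg_closed)
qed

text \<open>Both factors are regular and lie above the product, hence above its double negation; the
  product is their meet.\<close>

lemma regular_mult:
  assumes "x \<in> regular" "y \<in> regular"
  shows "x \<cdot> y \<in> regular"
proof (rule regularI)
  have xy: "x \<in> idem" "y \<in> idem" using assms regular_idem by auto
  then show "x \<cdot> y \<in> idem" by (rule idem_mult)
  then show "neg (neg (x \<cdot> y)) \<sqsubseteq> x \<cdot> y"
    using assms xy by (simp add: le_mult_iff neg_neg_le_iff mult_le_left mult_le_right)
qed

abbreviation idem_lattice ("\<D>")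
  where "\<D> \<equiv> L\<lparr>carrier := idem\<rparr>"

abbreviation regular_lattice ("\<R>")
  where "\<R> \<equiv> L\<lparr>carrier := regular\<rparr>"

text \<open>Suprema are inherited from \<open>L\<close>. Infima arise from the idempotent lower
  bounds only, so they need not agree with those of \<open>L\<close>.\<close>

lemma idem_complete_lattice: "complete_lattice \<D>"
proof -
  interpret D: partial_order \<D> by (rule partial_order_subset[OF idem_carrier])
  show ?thesis
  proof (rule D.complete_lattice_supI)
    fix A assume A: "A \<subseteq> carrier \<D>"
    then have A': "A \<subseteq> carrier L" using idem_carrier by auto
    have "is_lub \<D> (\<Squnion>A) A"
      using A A' by (intro is_lub_substructureI) (auto intro: idem_sup sup_upper sup_least)
    then show "\<exists>s. is_lub \<D> s A" ..
  qed
qed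

text \<open>The double negation of the infimum remains below each regular \<open>x\<close> in
  \<open>A\<close>, so it is an idempotent lower bound and lies below the infimum.\<close>

lemma regular_inf:
  assumes "A \<subseteq> regular"
  shows "\<Sqinter>\<^bsub>\<D>\<^esub> A \<in> regular"
proof (rule regularI)
  interpret D: complete_lattice \<D> by (rule idem_complete_lattice)
  have A: "A \<subseteq> carrier \<D>" using assms regular_idem by auto
  show m: "\<Sqinter>\<^bsub>\<D>\<^esub> A \<in> idem" using D.inf_closed[OF A] by simp
  have "neg (neg (\<Sqinter>\<^bsub>\<D>\<^esub> A)) \<sqsubseteq>\<^bsub>\<D>\<^esub> \<Sqinter>\<^bsub>\<D>\<^esub> A"
  proof (rule D.inf_greatest[OF A])
    show "neg (neg (\<Sqinter>\<^bsub>\<D>\<^esub> A)) \<sqsubseteq>\<^bsub>\<D>\<^esub> x" if "x \<in> A" for x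
      using D.inf_lower[OF A that] assms that neg_neg_le_iff[OF m] by auto
  qed simp
  then show "neg (neg (\<Sqinter>\<^bsub>\<D>\<^esub> A)) \<sqsubseteq> \<Sqinter>\<^bsub>\<D>\<^esub> A" by simp
qed

lemma regular_is_glb_inf:
  assumes "A \<subseteq> regular"
  shows "is_glb \<R> (\<Sqinter>\<^bsub>\<D>\<^esub> A) A"
proof -
  interpret D: complete_lattice \<D> by (rule idem_complete_lattice)
  have A: "A \<subseteq> carrier \<D>" using assms regular_idem by auto
  show ?thesis
    using assms regular_inf D.inf_lower[OF A] D.inf_greatest[OF A] regular_idem
    by (intro is_glb_substructureI) auto
qed

text \<open>Double negation is a reflection onto the regular elements, so it sends the supremum
  among idempotents, which is that of \<open>L\<close>, to the supremum in
  \<open>\<R>\<close>.\<close>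

lemma regular_is_lub_sup:
  assumes "A \<subseteq> regular"
  shows "is_lub \<R> (neg (neg (\<Squnion>A))) A"
proof -
  have A: "A \<subseteq> carrier L" "A \<subseteq> idem" using assms regular_idem regular_closed by auto
  then have s: "\<Squnion>A \<in> idem" by (simp add: idem_sup)
  show ?thesis
  proof (rule is_lub_substructureI)
    show "x \<sqsubseteq> neg (neg (\<Squnion>A))" if "x \<in> A" for x
      using le_neg_neg[OF s] sup_upper[OF A(1) that] A that
      by (meson idem_closed le_trans neg_closed s subsetD)
    show "neg (neg (\<Squnion>A)) \<sqsubseteq> y" if "y \<in> regular" "\<And>x. x \<in> A \<Longrightarrow> x \<sqsubseteq> y" for y
      using that A regular_closed s by (auto simp: neg_neg_le_iff intro!: sup_least)
  qed (use assms s in auto)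
qed

lemma regular_complete_lattice: "complete_lattice \<R>"
proof -
  interpret R: partial_order \<R> by (rule partial_order_subset[OF regular_closed])
  show ?thesis
    by (rule R.complete_lattice_supI) (auto dest: regular_is_lub_sup)
qed

lemma sup_regular: "A \<subseteq> regular \<Longrightarrow> \<Squnion>\<^bsub>\<R>\<^esub> A = neg (neg (\<Squnion>A))"
  using partial_order.sup_eqI[OF partial_order_subset[OF regular_closed]] regular_is_lub_sup .

lemma inf_regular: "A \<subseteq> regular \<Longrightarrow> \<Sqinter>\<^bsub>\<R>\<^esub> A = \<Sqinter>\<^bsub>\<D>\<^esub> A"
  using partial_order.inf_eqI[OF partial_order_subset[OF regular_closed]] regular_is_glb_inf .

lemma join_regular: "\<lbrakk>x \<in> regular; y \<in> regular\<rbrakk> \<Longrightarrow> x \<squnion>\<^bsub>\<R>\<^esub> y = neg (neg (x \<squnion> y))"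
  unfolding join_def by (rule sup_regular) simp

lemma meet_regular:
  assumes "x \<in> regular" "y \<in> regular"
  shows "x \<sqinter>\<^bsub>\<R>\<^esub> y = x \<cdot> y"
proof -
  have xy: "x \<in> idem" "y \<in> idem" using assms regular_idem by auto
  have "is_glb \<R> (x \<cdot> y) {x, y}"
    using assms xy regular_idem
    by (intro is_glb_substructureI) (auto simp: regular_mult mult_le_left mult_le_right le_mult_iff)
  then show ?thesis
    unfolding meet_def
    using partial_order.inf_eqI[OF partial_order_subset[OF regular_closed]] by blast
qed

text \<open>Both extremes of \<open>L\<close> are regular because \<open>neg\<close> exchanges
  them.\<close>

lemma top_regular: "\<top>\<^bsub>\<R>\<^esub> = \<top>" and bottom_regular: "\<bottom>\<^bsub>\<R>\<^esub> = \<bottom>"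
proof -
  interpret R: complete_lattice \<R> by (rule regular_complete_lattice)
  have "\<top> \<in> regular" "\<bottom> \<in> regular"
    using bottom_idem top_idem neg_regular[of \<bottom>] neg_regular[of \<top>] by (simp_all add: neg_bottom neg_top)
  then show "\<top>\<^bsub>\<R>\<^esub> = \<top>" "\<bottom>\<^bsub>\<R>\<^esub> = \<bottom>"
    using R.top_higher[of \<top>] R.bottom_lower[of \<bottom>] R.top_closed R.bottom_closed regular_closed
    by (auto intro!: le_antisym)
qed

text \<open>The complement is \<open>neg x\<close>. By De Morgan,
  \<open>neg (x \<squnion> neg x)\<close> lies below
  \<open>neg x \<cdot> neg (neg x) = \<bottom>\<close>, so the double negation of the join is
  \<open>\<top>\<close>, even where the join in \<open>L\<close> is smaller.\<close>

lemma regular_complemented: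
  assumes "x \<in> regular"
  shows "complemented_in \<R> x"
proof -
  have x: "x \<in> idem" using assms regular_idem by auto
  define s where "s = x \<squnion> neg x"
  have s: "s \<in> idem"
    unfolding s_def join_def using x by (intro idem_sup) simp
  have "x \<cdot> neg s = \<bottom>" "neg x \<cdot> neg s = \<bottom>"
    using x s neg_antimono[of x s] neg_antimono[of "neg x" s]
    by (auto simp: s_def join_left join_right simp flip: le_neg_iff)
  then have "neg s \<sqsubseteq> neg x" "neg s \<sqsubseteq> neg (neg x)"
    using x by (simp_all add: le_neg_iff)
  then have "neg s \<sqsubseteq> neg x \<cdot> neg (neg x)"
    by (simp add: le_mult_iff)
  then have "neg s = \<bottom>"
    by (simp add: mult_neg le_bottom_iff)
  then have "neg (neg (x \<squnion> neg x)) = \<top>"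
    by (simp add: s_def neg_bottom)
  then show ?thesis
    unfolding complemented_in_def using assms x
    by (auto intro!: bexI[of _ "neg x"]
        simp: join_regular meet_regular top_regular bottom_regular mult_neg)
qed

text \<open>With \<open>u = neg (x \<cdot> y \<squnion> x \<cdot> z)\<close>, the element \<open>u \<cdot> x\<close> annihilates
  \<open>y\<close> and \<open>z\<close>, so it lies below \<open>neg (y \<squnion> z)\<close> and hence
  annihilates \<open>neg (neg (y \<squnion> z))\<close>.\<close>

lemma regular_distrib:
  assumes "x \<in> regular" "y \<in> regular" "z \<in> regular"
  shows "x \<sqinter>\<^bsub>\<R>\<^esub> (y \<squnion>\<^bsub>\<R>\<^esub> z) = (x \<sqinter>\<^bsub>\<R>\<^esub> y) \<squnion>\<^bsub>\<R>\<^esub> (x \<sqinter>\<^bsub>\<R>\<^esub> z)"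
proof -
  have xyz: "x \<in> idem" "y \<in> idem" "z \<in> idem" using assms regular_idem by auto
  define s where "s = y \<squnion> z"
  define t where "t = x \<cdot> y \<squnion> x \<cdot> z"
  define u where "u = neg t"
  have s: "s \<in> idem" and t: "t \<in> idem"
    unfolding s_def t_def join_def using xyz by (auto intro!: idem_sup idem_mult)
  have u: "u \<in> idem" by (simp add: u_def)
  have xt: "t = x \<cdot> s"
    using mult_sup[of x "{y, z}"] xyz by (simp add: s_def t_def join_def)
  have "s \<cdot> (x \<cdot> u) = t \<cdot> u"
    using xyz s u by (simp add: xt mult_ac)
  also have "\<dots> = \<bottom>"
    using t by (simp add: u_def mult_neg)
  finally have "x \<cdot> u \<sqsubseteq> neg s"
    using xyz s u by (simp add: le_neg_iff idem_mult)
  then have "neg (neg s) \<sqsubseteq> neg (x \<cdot> u)"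
    using xyz u by (intro neg_antimono) (auto simp: idem_mult)
  then have "(x \<cdot> u) \<cdot> neg (neg s) = \<bottom>"
    using xyz u by (simp add: le_neg_iff)
  then have "u \<cdot> (x \<cdot> neg (neg s)) = \<bottom>"
    using xyz u by (simp add: mult_ac)
  then have "x \<cdot> neg (neg s) \<sqsubseteq> neg (neg t)"
    using xyz by (simp add: u_def le_neg_iff idem_mult)
  \<comment> \<open>Conversely, the right-hand side is regular, so it only has to lie above
    \<open>t = x \<cdot> s\<close>.\<close>
  moreover have "neg (neg t) \<sqsubseteq> x \<cdot> neg (neg s)"
    using assms xyz s t
    by (simp add: neg_neg_le_iff regular_mult)
      (simp add: xt mult_mono_right le_neg_neg)
  ultimately have "x \<cdot> neg (neg s) = neg (neg t)"
    using xyz by (intro le_antisym) auto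
  then show ?thesis
    using assms xyz s
    by (simp add: join_regular meet_regular regular_mult flip: s_def t_def)
qed

lemma regular_complete_boolean_lattice: "complete_boolean_lattice \<R>"
  unfolding complete_boolean_lattice_def complete_boolean_lattice_axioms_def
  using regular_complete_lattice regular_distrib regular_complemented by simp

lemma regular_inf_pres: "inf_pres \<R> \<D> (\<lambda>x. x)"
  using regular_complete_lattice idem_complete_lattice inf_regular by (simp add: inf_pres_def)

lemma neg_neg_galois_connection:
  "galois_connection \<lparr>orderA = \<D>, orderB = \<R>, lower = (\<lambda>x. neg (neg x)), upper = (\<lambda>x. x)\<rparr>"
  using regular_idem partial_order_subset[OF idem_carrier] partial_order_subset[OF regular_closed]
  by (auto simp: galois_connection_def connection_def galois_connection_axioms_def neg_neg_le_iff)

end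


section \<open>Zero objects, wedges and smash products\<close>

context preadditive_category
begin

lemma mor_is_group: "group (Mor C X Y)"
  using mor_group comm_group.axioms(2) by blast

lemma zero_arrow_closed [simp]: "zero_arrow C X Y \<in> arrows C X Y"
  by (rule monoid.one_closed[OF group.is_monoid[OF mor_is_group]])

text \<open>By bilinearity the composite equals its own double, and in a group this forces it to be
  zero.\<close>

lemma zero_comp:
  assumes "f \<in> arrows C X Y"
  shows "zero_arrow C Y Z \<odot> f = zero_arrow C X Z"
proof -
  interpret YZ: group "Mor C Y Z" by (rule mor_is_group)
  interpret XZ: group "Mor C X Z" by (rule mor_is_group)
  have "(zero_arrow C Y Z \<odot> f) \<otimes>\<^bsub>Mor C X Z\<^esub> (zero_arrow C Y Z \<odot> f) = zero_arrow C Y Z \<odot> f"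
    using comp_add_left[OF assms, of "zero_arrow C Y Z" Z "zero_arrow C Y Z"] by simp
  then show ?thesis
    using comp_closed[OF assms zero_arrow_closed, of Z] by simp
qed

lemma comp_zero:
  assumes "g \<in> arrows C Y Z"
  shows "g \<odot> zero_arrow C X Y = zero_arrow C X Z"
proof -
  interpret XY: group "Mor C X Y" by (rule mor_is_group)
  interpret XZ: group "Mor C X Z" by (rule mor_is_group)
  have "(g \<odot> zero_arrow C X Y) \<otimes>\<^bsub>Mor C X Z\<^esub> (g \<odot> zero_arrow C X Y) = g \<odot> zero_arrow C X Y"
    using comp_add_right[OF _ _ assms, of "zero_arrow C X Y" X "zero_arrow C X Y"] by simp
  then show ?thesis
    using comp_closed[OF zero_arrow_closed assms, of X] by simp
qed

text \<open>Every arrow into or out of \<open>X\<close> factors through the identity of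
  \<open>X\<close>, so one equation decides.\<close>

lemma is_zero_object_iff: "is_zero_object C X \<longleftrightarrow> Ident C X = zero_arrow C X X"
proof
  assume "is_zero_object C X"
  then show "Ident C X = zero_arrow C X X"
    using ident_closed[of X] unfolding is_zero_object_def by blast
next
  assume X: "Ident C X = zero_arrow C X X"
  have "f = zero_arrow C X Y" if "f \<in> arrows C X Y" for f Y
    using comp_ident[OF that] comp_zero[OF that] X by metis
  moreover have "f = zero_arrow C Y X" if "f \<in> arrows C Y X" for f Y
    using ident_comp[OF that] zero_comp[OF that] X by metis
  ultimately show "is_zero_object C X"
    unfolding is_zero_object_def using zero_arrow_closed by blast
qed

lemma is_zero_object_retract:
  assumes "f \<in> arrows C X Y" "g \<in> arrows C Y X" "g \<odot> f = Ident C X" "is_zero_object C Y"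
  shows "is_zero_object C X"
proof -
  have "f = zero_arrow C X Y"
    using assms(1,4) unfolding is_zero_object_def by blast
  then show ?thesis
    using assms(2,3) comp_zero by (simp add: is_zero_object_iff)
qed

lemma is_zero_object_iso: "is_iso C X Y f \<Longrightarrow> is_zero_object C X \<longleftrightarrow> is_zero_object C Y"
  unfolding is_iso_def using is_zero_object_retract by blast

text \<open>Each summand is a retract of the wedge, by the identity on itself and zero on the other
  summands. Conversely, over zero summands the identity and the zero arrow of \<open>W\<close> have
  the same restrictions, so they agree.\<close>

lemma is_zero_object_coproduct:
  assumes W: "is_coproduct C J D W \<iota>"
  shows "is_zero_object C W \<longleftrightarrow> (\<forall>j\<in>J. is_zero_object C (D j))"
proof
  have incl: "\<iota> j \<in> arrows C (D j) W" if "j \<in> J" for j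
    using W that by (simp add: is_coproduct_def)
  have univ: "\<exists>!h. h \<in> arrows C W Y \<and> (\<forall>j\<in>J. h \<odot> \<iota> j = f j)"
    if "\<And>j. j \<in> J \<Longrightarrow> f j \<in> arrows C (D j) Y" for Y f
    using W that unfolding is_coproduct_def by blast
  show "\<forall>j\<in>J. is_zero_object C (D j)" if "is_zero_object C W"
  proof
    fix j assume j: "j \<in> J"
    define f where "f i = (if i = j then Ident C (D j) else zero_arrow C (D i) (D j))" for i
    have "f i \<in> arrows C (D i) (D j)" for i
      by (simp add: f_def ident_closed)
    then obtain h where "h \<in> arrows C W (D j)" "h \<odot> \<iota> j = f j"
      using univ[of f "D j"] j by blast
    then show "is_zero_object C (D j)"
      using is_zero_object_retract[OF incl[OF j] _ _ that] by (simp add: f_def)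
  qed
  show "is_zero_object C W" if D: "\<forall>j\<in>J. is_zero_object C (D j)"
  proof -
    have "\<iota> j = zero_arrow C (D j) W" if "j \<in> J" for j
      using D incl[OF that] that unfolding is_zero_object_def by blast
    then have "\<forall>j\<in>J. Ident C W \<odot> \<iota> j = zero_arrow C (D j) W"
      "\<forall>j\<in>J. zero_arrow C W W \<odot> \<iota> j = zero_arrow C (D j) W"
      using ident_comp[OF incl] zero_comp[OF incl] by auto
    then have "Ident C W = zero_arrow C W W"
      using univ[of "\<lambda>j. zero_arrow C (D j) W" W] ident_closed[of W]
        zero_arrow_closed by blast
    then show ?thesis
      by (simp add: is_zero_object_iff)
  qed
qed

end

section \<open>Smash products and Bousfield classes\<close>

context symmetric_monoidal_category
begin

text \<open>Additivity of the smash product carries the equation "identity plus identity equals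
  identity" from \<open>X\<close> to \<open>X \<triangle> Y\<close>, where cancellation makes the
  identity zero.\<close>

lemma is_zero_object_smash:
  assumes "is_zero_object C X"
  shows "is_zero_object C (X \<triangle> Y)"
proof -
  interpret XX: group "Mor C X X" by (rule mor_is_group)
  interpret M: group "Mor C (X \<triangle> Y) (X \<triangle> Y)" by (rule mor_is_group)
  let ?f = "Ident C X \<diamondop> Ident C Y"
  have "Ident C X \<otimes>\<^bsub>Mor C X X\<^esub> Ident C X = Ident C X"
    using assms by (simp add: is_zero_object_iff)
  then have "?f \<otimes>\<^bsub>Mor C (X \<triangle> Y) (X \<triangle> Y)\<^esub> ?f = ?f"
    using smash_add[OF ident_closed[of X] ident_closed[of X] ident_closed[of Y]] by simp
  then have "?f = zero_arrow C (X \<triangle> Y) (X \<triangle> Y)"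
    using smash_closed[OF ident_closed ident_closed, of X Y] by simp
  then show ?thesis
    by (simp add: smash_ident is_zero_object_iff)
qed

lemma is_iso_ident: "is_iso C X X (Ident C X)"
  unfolding is_iso_def using comp_ident ident_closed by blast

lemma braid_iso: "is_iso C (X \<triangle> Y) (Y \<triangle> X) (Braid C X Y)"
  unfolding is_iso_def using braid_closed braid_symmetric by blast

lemma is_iso_smash:
  assumes "is_iso C X X' f" "is_iso C Y Y' g"
  shows "is_iso C (X \<triangle> Y) (X' \<triangle> Y') (f \<diamondop> g)"
proof -
  obtain f' g' where f: "f \<in> arrows C X X'" "f' \<in> arrows C X' X" "f' \<odot> f = Ident C X" "f \<odot> f' = Ident C X'"
    and g: "g \<in> arrows C Y Y'" "g' \<in> arrows C Y' Y" "g' \<odot> g = Ident C Y" "g \<odot> g' = Ident C Y'"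
    using assms unfolding is_iso_def by blast
  have "(f' \<diamondop> g') \<odot> (f \<diamondop> g) = Ident C (X \<triangle> Y)" "(f \<diamondop> g) \<odot> (f' \<diamondop> g') = Ident C (X' \<triangle> Y')"
    using f g by (simp_all add: smash_ident flip: smash_comp)
  then show ?thesis
    unfolding is_iso_def using f(1,2) g(1,2) smash_closed by blast
qed

lemma mem_bousfield_class: "Z \<in> bousfield_class C E \<longleftrightarrow> is_zero_object C (E \<triangle> Z)"
  by (simp add: bousfield_class_def)

text \<open>Associativity moves \<open>F\<close> to the test object, so the class of
  \<open>E \<triangle> F\<close> depends on \<open>E\<close> only through its class; with the
  braiding the same holds for \<open>F\<close>.\<close>

lemma mem_bousfield_class_smash: "Z \<in> bousfield_class C (E \<triangle> F) \<longleftrightarrow> F \<triangle> Z \<in> bousfield_class C E"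
  unfolding mem_bousfield_class by (rule is_zero_object_iso[OF assoc_iso])

lemma bousfield_class_iso: "is_iso C E F f \<Longrightarrow> bousfield_class C E = bousfield_class C F"
  using is_zero_object_iso[OF is_iso_smash[OF _ is_iso_ident]] by (auto simp: mem_bousfield_class)

lemma bousfield_class_smash_commute: "bousfield_class C (E \<triangle> F) = bousfield_class C (F \<triangle> E)"
  by (rule bousfield_class_iso[OF braid_iso])

lemma bousfield_class_smash_assoc:
  "bousfield_class C ((E \<triangle> F) \<triangle> G) = bousfield_class C (E \<triangle> (F \<triangle> G))"
  by (rule bousfield_class_iso[OF assoc_iso])

lemma bousfield_class_sphere_smash: "bousfield_class C (Sphere C \<triangle> E) = bousfield_class C E"
  by (rule bousfield_class_iso[OF lunit_iso])

lemma bousfield_class_smash_cong: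
  assumes "bousfield_class C E = bousfield_class C E'" "bousfield_class C F = bousfield_class C F'"
  shows "bousfield_class C (E \<triangle> F) = bousfield_class C (E' \<triangle> F')"
proof -
  have "bousfield_class C (E \<triangle> F) = bousfield_class C (E' \<triangle> F)"
    using assms(1) by (auto simp: mem_bousfield_class_smash)
  also have "\<dots> = bousfield_class C (F \<triangle> E')"
    by (rule bousfield_class_smash_commute)
  also have "\<dots> = bousfield_class C (F' \<triangle> E')"
    using assms(2) by (auto simp: mem_bousfield_class_smash)
  also have "\<dots> = bousfield_class C (E' \<triangle> F')"
    by (rule bousfield_class_smash_commute)
  finally show ?thesis .
qed

text \<open>Independence of representatives makes the definite description denote.\<close>

lemma class_smash_bousfield_class:
  "class_smash C (bousfield_class C E) (bousfield_class C F) = bousfield_class C (E \<triangle> F)"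
  unfolding class_smash_def by (rule the_equality) (use bousfield_class_smash_cong in blast)+

lemma bousfield_class_zero: "is_zero_object C X \<Longrightarrow> bousfield_class C X = UNIV"
  by (simp add: bousfield_class_def is_zero_object_smash)

text \<open>A sphere-acyclic spectrum is zero, hence acyclic for every \<open>E\<close>. As the
  order reverses inclusion, the sphere represents the top class.\<close>

lemma bousfield_class_sphere_subset: "bousfield_class C (Sphere C) \<subseteq> bousfield_class C E"
proof
  fix Z assume "Z \<in> bousfield_class C (Sphere C)"
  then have "is_zero_object C (Z \<triangle> E)"
    using is_zero_object_iso[OF lunit_iso] is_zero_object_smash by (simp add: mem_bousfield_class)
  then show "Z \<in> bousfield_class C E"
    using is_zero_object_iso[OF braid_iso] by (simp add: mem_bousfield_class)
qed

end

section \<open>The Bousfield lattice as an integral quantale\<close>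

context p_local_stable_homotopy_category
begin

text \<open>Smashing preserves the wedge, and a wedge vanishes exactly when all its summands
  do.\<close>

lemma bousfield_class_coproduct:
  assumes "J \<subseteq> I" "is_coproduct C J D W \<iota>"
  shows "bousfield_class C W = (\<Inter>j\<in>J. bousfield_class C (D j))"
  using is_zero_object_coproduct[OF smash_wedge[OF assms]] by (auto simp: mem_bousfield_class)

text \<open>Ohkawa's theorem makes every family of Bousfield classes small, so its wedge exists.\<close>

lemma bousfield_class_Inter:
  assumes "A \<subseteq> range (bousfield_class C)"
  shows "\<Inter>A \<in> range (bousfield_class C)"
proof -
  obtain X :: "'i \<Rightarrow> 'o" where X: "range (bousfield_class C) = (bousfield_class C \<circ> X) ` I"
    using ohkawa by blast
  define J where "J = {i \<in> I. bousfield_class C (X i) \<in> A}"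
  have "J \<subseteq> I" by (auto simp: J_def)
  moreover obtain W \<iota> where "is_coproduct C J X W \<iota>"
    using wedge_exists[OF \<open>J \<subseteq> I\<close>] by blast
  ultimately have "bousfield_class C W = (\<Inter>j\<in>J. bousfield_class C (X j))"
    by (rule bousfield_class_coproduct)
  moreover have "(\<lambda>j. bousfield_class C (X j)) ` J = A"
    using assms unfolding X J_def comp_def by blast
  ultimately show ?thesis by (metis rangeI)
qed

lemma carrier_bousfield_lattice: "carrier \<B> = range (bousfield_class C)"
  by (simp add: bousfield_lattice_def)

lemma le_bousfield_lattice: "x \<sqsubseteq>\<^bsub>\<B>\<^esub> y \<longleftrightarrow> y \<subseteq> x"
  by (simp add: bousfield_lattice_def)

lemma bousfield_partial_order: "partial_order \<B>"
  by unfold_locales (auto simp: bousfield_lattice_def)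

text \<open>The order is reversed inclusion, so suprema are intersections; the empty one is
  \<open>UNIV\<close>, the class of a zero object.\<close>

lemma bousfield_is_lub:
  assumes "A \<subseteq> carrier \<B>"
  shows "is_lub \<B> (\<Inter>A) A"
  using assms bousfield_class_Inter
  by (auto simp: least_def Upper_def carrier_bousfield_lattice le_bousfield_lattice)

lemma bousfield_complete_lattice: "complete_lattice \<B>"
  using partial_order.complete_lattice_supI[OF bousfield_partial_order] bousfield_is_lub by blast

lemma bousfield_sup: "A \<subseteq> carrier \<B> \<Longrightarrow> \<Squnion>\<^bsub>\<B>\<^esub> A = \<Inter>A"
  using partial_order.sup_eqI[OF bousfield_partial_order] bousfield_is_lub by blast

lemma bousfield_top: "\<top>\<^bsub>\<B>\<^esub> = bousfield_class C (Sphere C)"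
proof -
  interpret B: complete_lattice \<B> by (rule bousfield_complete_lattice)
  have "bousfield_class C (Sphere C) \<subseteq> \<top>\<^bsub>\<B>\<^esub>"
    using B.top_closed bousfield_class_sphere_subset by (auto simp: carrier_bousfield_lattice)
  moreover have "\<top>\<^bsub>\<B>\<^esub> \<subseteq> bousfield_class C (Sphere C)"
    using B.top_higher[of "bousfield_class C (Sphere C)"]
    by (simp add: carrier_bousfield_lattice le_bousfield_lattice)
  ultimately show ?thesis by simp
qed

lemma bousfield_bottom: "\<bottom>\<^bsub>\<B>\<^esub> = class_zero C"
proof -
  interpret B: complete_lattice \<B> by (rule bousfield_complete_lattice)
  obtain X where X: "is_zero_object C X"
    using zero_exists by blast
  then have U: "class_zero C = UNIV" "UNIV \<in> carrier \<B>"
    unfolding class_zero_def carrier_bousfield_lattice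
    using bousfield_class_zero by (auto intro!: the_equality)
  then show ?thesis
    using B.bottom_lower[of UNIV] by (simp add: le_bousfield_lattice top.extremum_unique)
qed

lemma bousfield_integral_quantale: "integral_quantale \<B> (class_smash C)"
proof -
  interpret B: complete_lattice \<B> by (rule bousfield_complete_lattice)
  show ?thesis
  proof
    fix x y z A
    assume x: "x \<in> carrier \<B>"
    then obtain E where E: "x = bousfield_class C E"
      by (auto simp: carrier_bousfield_lattice)
    show "class_smash C x \<top>\<^bsub>\<B>\<^esub> = x"
      using bousfield_class_smash_commute bousfield_class_sphere_smash
      by (simp add: E bousfield_top class_smash_bousfield_class)
    show "class_smash C x (\<Squnion>\<^bsub>\<B>\<^esub> A) = \<Squnion>\<^bsub>\<B>\<^esub> (class_smash C x ` A)" if A: "A \<subseteq> carrier \<B>"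
    proof -
      \<comment> \<open>After braiding, smashing with \<open>E\<close> is the inverse image under
        \<open>Z \<mapsto> E \<triangle> Z\<close>, and inverse images commute with
        intersections.\<close>
      have smash: "class_smash C x (bousfield_class C F) = {Z. E \<triangle> Z \<in> bousfield_class C F}" for F
        by (auto simp: E class_smash_bousfield_class bousfield_class_smash_commute[of E]
            mem_bousfield_class_smash)
      have "class_smash C x ` A \<subseteq> carrier \<B>"
        using A by (auto simp: E carrier_bousfield_lattice class_smash_bousfield_class)
      \<comment> \<open>The intersection is itself a Bousfield class, so \<open>smash\<close>
        applies to it too.\<close>
      moreover obtain W where W: "\<Inter>A = bousfield_class C W"
        using bousfield_class_Inter A unfolding carrier_bousfield_lattice by blast
      have "class_smash C x (\<Inter>A) = \<Inter>(class_smash C x ` A)"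
      proof -
        have "class_smash C x y = {Z. E \<triangle> Z \<in> y}" if "y \<in> A" for y
          using A that smash by (auto simp: carrier_bousfield_lattice)
        then show ?thesis
          using smash[of W] by (auto simp flip: W)
      qed
      ultimately show ?thesis
        using A by (simp add: bousfield_sup)
    qed
    assume y: "y \<in> carrier \<B>"
    then obtain F where F: "y = bousfield_class C F"
      by (auto simp: carrier_bousfield_lattice)
    show "class_smash C x y \<in> carrier \<B>"
      by (simp add: E F class_smash_bousfield_class carrier_bousfield_lattice)
    show "class_smash C x y = class_smash C y x"
      unfolding E F class_smash_bousfield_class by (rule bousfield_class_smash_commute)
    assume "z \<in> carrier \<B>"
    then obtain G where G: "z = bousfield_class C G"
      by (auto simp: carrier_bousfield_lattice)
    show "class_smash C (class_smash C x y) z = class_smash C x (class_smash C y z)"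
      unfolding E F G class_smash_bousfield_class by (rule bousfield_class_smash_assoc)
  qed
qed

end

section \<open>Transfer from the quantale to the closed Bousfield classes\<close>

theorem theorem6p4:
  fixes p :: nat and I :: "'i set" and C :: "('o, 'm) tensor_triangulated"
  assumes "p_local_stable_homotopy_category p I C"
  shows
    "(\<forall>S \<subseteq> carrier (cBA C). \<exists>m \<in> carrier (cBA C). greatest (DL C) m (Lower (DL C) S)) \<and>
     complete_lattice (cBA C) \<and>
     (\<forall>S \<subseteq> carrier (cBA C).
        \<Squnion>\<^bsub>cBA C\<^esub> S = complement_op C (complement_op C (\<Squnion>\<^bsub>\<B>\<^bsub>C\<^esub>\<^esub> S))) \<and>
     (\<forall>x \<in> carrier (cBA C). complemented_in (cBA C) x) \<and>
     complete_boolean_lattice (cBA C) \<and>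
     inf_pres (cBA C) (DL C) (\<lambda>x. x) \<and>
     galois_connection
       \<lparr>orderA = DL C, orderB = cBA C,
        lower = (\<lambda>x. complement_op C (complement_op C x)), upper = (\<lambda>x. x)\<rparr>"
proof -
  interpret p_local_stable_homotopy_category p I C by (rule assms)
  interpret Q: integral_quantale "\<B>\<^bsub>C\<^esub>" "class_smash C"
    by (rule bousfield_integral_quantale)
  \<comment> \<open>The two descriptions of idempotents differ in the orientation of the
    equation.\<close>
  have "{x \<in> carrier \<B>\<^bsub>C\<^esub>. x = class_smash C x x} = Q.idem"
    unfolding Q.idem_def by (rule Collect_cong) blast
  then have DL: "DL C = Q.idem_lattice"
    by (simp only: DL_def)
  \<comment> \<open>Both operations are built from the same suprema once \<open>class_zero\<close>
    is rewritten as the bottom element.\<close>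
  then have A: "complement_op C = Q.neg"
    by (intro ext)
      (simp add: complement_op_def annihilator_def retraction_def
        Q.neg_def Q.ann_def Q.retr_def bousfield_bottom)
  have "{x \<in> Q.idem. Q.neg (Q.neg x) = x} = Q.regular"
    by (simp only: Q.regular_def)
  then have cBA: "cBA C = Q.regular_lattice"
    by (simp add: cBA_def DL A)
  interpret D: complete_lattice Q.idem_lattice
    by (rule Q.idem_complete_lattice)
  have "\<exists>m \<in> Q.regular. is_glb Q.idem_lattice m S" if "S \<subseteq> Q.regular" for S
  proof
    show "is_glb Q.idem_lattice (\<Sqinter>\<^bsub>Q.idem_lattice\<^esub> S) S"
      using that Q.regular_idem by (intro D.inf_glb) auto
  qed (rule Q.regular_inf[OF that])
  moreover have "carrier Q.regular_lattice = Q.regular"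
    by simp
  ultimately show ?thesis
    unfolding DL A cBA
    using Q.regular_complete_lattice Q.sup_regular Q.regular_complemented
      Q.regular_complete_boolean_lattice Q.regular_inf_pres Q.neg_neg_galois_connection
    by metis
qed

end
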